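(* Consider the semidiscrete scheme consisting, for every element $e\in\mathcal{E}$, of the system of ordinary differential equations $$M_J \frac{d p}{dt} + S_x v_x + S_y v_y = -\sum_{g\in\mathcal{G}^e} (L^g)^T S_J^g W^g\,(v_n^* - v_n^-),$$ $$M_J \frac{d v_x}{dt} - S_x^T p = -\sum_{g\in\mathcal{G}^e} (L^g)^T n_x^{-g} S_J^g W^g\, p^*,$$ $$M_J \frac{d v_y}{dt} - S_y^T p = -\sum_{g\in\mathcal{G}^e} (L^g)^T n_y^{-g} S_J^g W^g\, p^*,$$ with all matrices and the numerical fluxes $p^*$, $v_n^*$ (with parameter $\alpha\ge 0$) as defined in the context. Assume that $M_J$ is symmetric positive definite for every $e\in\mathcal{E}$ and that (the diagonal entries of) $S_J^g$ are positive for every mortar element $g\in\mathcal{G}$. Let $$\mathcal{F} = \sum_{e\in\mathcal{E}} \mathcal{F}^e,\qquad \mathcal{F}^e = \tfrac12\left(p^T M_J p + v_x^T M_J v_x + v_y^T M_J v_y\right).$$ Then every solution of the semidiscrete scheme satisfies the energy estimate $\mathcal{F}(t)\le \mathcal{F}(0)$ for all $t>0$.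
   Context: Model problem: the 2D acoustic wave equation $\partial_t p + \nabla\cdot v = 0$, $\partial_t v + \nabla p = 0$ on a domain $\Omega\subset\mathbb{R}^2$, with $v=(v_x,v_y)$ and either periodic boundary conditions or the boundary condition $n\cdot v=0$ on $\partial\Omega$. Mesh. $\Omega$ is partitioned into a finite set $\mathcal{E}$ of non-overlapping elements, each the image of a reference element $\hat e$ with coordinates $(r,s)$. The mortar $\Gamma=\bigcup_{e}\partial e$ is partitioned into a finite set $\mathcal{G}$ of non-overlapping one-dimensional mortar elements, each the image of a reference interval $\hat g$; each mortar element meets the boundary of at most two elements. $\mathcal{G}^e$ is the set of mortar elements connected to $e$. A mortar element connected to two elements is an interior mortar (with periodic boundary conditions all mortars are interior, opposite boundary parts being identified); one connected to a single element is a boundary mortar. Unknowns. For each $e$ there is a finite-dimensional space $V_h^e$ of functions on $\hat e$ with a basis $\{\phi_k\}$; $p, v_x, v_y$ denote the time-dependent coefficient vectors (in this basis) of the discrete pressure and velocity components on $e$. All vectors and matrices below depend on the element $e$ in general, although this is suppressed in the notation. Volume matrices. $W$ is the diagonal matrix of the strictly positive weights of a quadrature rule on $\hat e$; $J$ is the diagonal matrix of values of the Jacobian determinant at the quadrature nodes; $L$ evaluates a function of $V_h^e$ (given by its coefficients) at the quadrature nodes; $D_r$, $D_s$ evaluate its $r$- and $s$-derivatives at the quadrature nodes; $r_x,s_x,r_y,s_y$ are diagonal matrices of (possibly approximate) values of the metric derivatives $\partial r/\partial x,\partial s/\partial x,\partial r/\partial y,\partial s/\partial y$ at the quadrature nodes.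 Then $$M_J = L^T W J L,\quad S_x = L^T W J(r_x D_r + s_x D_s),\quad S_y = L^T W J (r_y D_r + s_y D_s).$$ No exactness of the quadrature is assumed. Mortar matrices. For each $g\in\mathcal{G}$ a quadrature rule on $\hat g$ with positive weights is fixed; $W^g$ is the diagonal matrix of its weights and $S_J^g$ the diagonal matrix of values of the surface Jacobian determinant at its nodes. $W^g$ and $S_J^g$ are the same for the two elements sharing $g$. $L^g$ (depending on the element $e$) maps the coefficient vector of a function in $V_h^e$ to the values of its trace at the quadrature nodes of $g$. $n_x^{-g}$, $n_y^{-g}$ are the diagonal matrices of components, at the mortar quadrature nodes, of the unit normal to $g$ outward with respect to $e$; for the two elements sharing $g$ these normals are equal in magnitude and opposite in sign. Fluxes. As seen from element $e$ on $g\in\mathcal{G}^e$: $p^- = L^g p$ and $v_n^- = n_x^{-g}L^g v_x + n_y^{-g}L^g v_y$ are computed from $e$; on an interior mortar, $p^+$ and $v_n^+$ are the values at the same nodes computed from the other element connected to $g$ (with its own interpolation matrix), where $v_n^+$ uses the same normal $n^{-g}$ (outward to $e$). On a boundary mortar one sets $p^+ = p^-$ and $v_n^+ = -v_n^-$. The fluxes are, componentwise, $$p^* = \tfrac12(p^+ + p^-) - \tfrac{\alpha}{2}(v_n^+ - v_n^-),\qquad v_n^* = \tfrac12(v_n^+ + v_n^-) - \tfrac{\alpha}{2}(p^+ - p^-),$$ for a constant $\alpha\ge0$. *)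

theory Defs
  imports "HOL-Analysis.Analysis" "Jordan_Normal_Form.Matrix"
begin

text \<open>
  Points of the plane, both reference coordinates \<open>(r, s)\<close> and physical coordinates \<open>(x, y)\<close>,
  are pairs of reals.  Elements and mortar elements are referred to by labels.  Matrices and
  vectors come from \<^theory>\<open>Jordan_Normal_Form.Matrix\<close>, since their sizes vary from element to
  element and from mortar to mortar.

  Periodic boundary conditions are encoded by the group \<open>periods\<close> of the translations that
  identify opposite boundary parts; it is the trivial group when the boundary condition is
  \<open>n \<sqdot> v = 0\<close>.  On a periodic mesh, the copy of the mortar element \<open>g\<close> lying on the boundary of
  the element \<open>e\<close> may differ from the image of \<open>mortar_map g\<close> by such a translation.

  \<open>V\<^sub>h\<^sup>e\<close> is the span of \<open>basis_fun e k\<close>, \<open>k < dim_V e\<close>, as functions on \<open>ref_elem e\<close>.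
\<close>

record ('e, 'g) discretization =
  Omega :: "(real \<times> real) set"
  periods :: "(real \<times> real) set"
  elements :: "'e set"
  ref_elem :: "'e \<Rightarrow> (real \<times> real) set"
  elem_map :: "'e \<Rightarrow> real \<times> real \<Rightarrow> real \<times> real"
  dim_V :: "'e \<Rightarrow> nat"
  basis_fun :: "'e \<Rightarrow> nat \<Rightarrow> real \<times> real \<Rightarrow> real"
  num_nodes :: "'e \<Rightarrow> nat"
  node :: "'e \<Rightarrow> nat \<Rightarrow> real \<times> real"
  weight :: "'e \<Rightarrow> nat \<Rightarrow> real"
  \<comment> \<open>values of the metric derivatives at the nodes; unconstrained, as they may be approximate\<close>
  metric_rx :: "'e \<Rightarrow> nat \<Rightarrow> real"
  metric_sx :: "'e \<Rightarrow> nat \<Rightarrow> real"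
  metric_ry :: "'e \<Rightarrow> nat \<Rightarrow> real"
  metric_sy :: "'e \<Rightarrow> nat \<Rightarrow> real"
  mortars :: "'g set"
  ref_mortar :: "'g \<Rightarrow> real set"
  mortar_map :: "'g \<Rightarrow> real \<Rightarrow> real \<times> real"
  num_mortar_nodes :: "'g \<Rightarrow> nat"
  mortar_node :: "'g \<Rightarrow> nat \<Rightarrow> real"
  mortar_weight :: "'g \<Rightarrow> nat \<Rightarrow> real"
  \<comment> \<open>the points of \<open>g\<close>, in the reference coordinates of \<open>e\<close>\<close>
  trace_map :: "'e \<Rightarrow> 'g \<Rightarrow> real \<Rightarrow> real \<times> real"
  \<comment> \<open>the unit normal to \<open>g\<close> that is outward with respect to \<open>e\<close>\<close>
  normal :: "'e \<Rightarrow> 'g \<Rightarrow> real \<Rightarrow> real \<times> real"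


definition elem_set :: "('e, 'g) discretization \<Rightarrow> 'e \<Rightarrow> (real \<times> real) set" where
  "elem_set D e = elem_map D e ` ref_elem D e"

definition mortar_set :: "('e, 'g) discretization \<Rightarrow> 'g \<Rightarrow> (real \<times> real) set" where
  "mortar_set D g = mortar_map D g ` ref_mortar D g"

text \<open>
  The end points of a mortar element are disregarded, as they also lie on the boundaries of
  elements that merely have a vertex there.
\<close>

definition open_mortar_set :: "('e, 'g) discretization \<Rightarrow> 'g \<Rightarrow> (real \<times> real) set" where
  "open_mortar_set D g = mortar_map D g ` interior (ref_mortar D g)"

definition connected_elems :: "('e, 'g) discretization \<Rightarrow> 'g \<Rightarrow> 'e set" where
  "connected_elems D g = {e \<in> elements D. \<exists>a\<in>periods D.
     (+) a ` open_mortar_set D g \<inter> frontier (elem_set D e) \<noteq> {}}"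

definition elem_mortars :: "('e, 'g) discretization \<Rightarrow> 'e \<Rightarrow> 'g set" where
  "elem_mortars D e = {g \<in> mortars D. e \<in> connected_elems D g}"

definition interior_mortar :: "('e, 'g) discretization \<Rightarrow> 'g \<Rightarrow> bool" where
  "interior_mortar D g \<longleftrightarrow> card (connected_elems D g) = 2"

definition other_elem :: "('e, 'g) discretization \<Rightarrow> 'e \<Rightarrow> 'g \<Rightarrow> 'e" where
  "other_elem D e g = (THE e'. e' \<in> connected_elems D g \<and> e' \<noteq> e)"

definition mortar_tangent :: "('e, 'g) discretization \<Rightarrow> 'g \<Rightarrow> real \<Rightarrow> real \<times> real" where
  "mortar_tangent D g \<xi> = vector_derivative (mortar_map D g) (at \<xi> within ref_mortar D g)"

text \<open>
  Outwardness is only required at interior points of the mortar element: at an end point, which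
  may be a corner of \<open>e\<close>, the normal is determined by continuity.
\<close>

definition outward_unit_normal ::
  "('e, 'g) discretization \<Rightarrow> 'e \<Rightarrow> 'g \<Rightarrow> (real \<Rightarrow> real \<times> real) \<Rightarrow> bool" where
  "outward_unit_normal D e g n \<longleftrightarrow>
     continuous_on (ref_mortar D g) n \<and>
     (\<forall>\<xi>\<in>ref_mortar D g. norm (n \<xi>) = 1 \<and> inner (n \<xi>) (mortar_tangent D g \<xi>) = 0) \<and>
     (\<forall>\<xi>\<in>interior (ref_mortar D g). \<exists>\<epsilon>>0. \<forall>h. 0 < h \<and> h < \<epsilon> \<longrightarrow>
        elem_map D e (trace_map D e g \<xi>) + h *\<^sub>R n \<xi> \<notin> elem_set D e \<and>
        elem_map D e (trace_map D e g \<xi>) - h *\<^sub>R n \<xi> \<in> elem_set D e)"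

locale dg_discretization =
  fixes D :: "('e, 'g) discretization"
  assumes Omega: "open (Omega D)" "connected (Omega D)" "Omega D \<noteq> {}"
    and periods: "0 \<in> periods D"
      "\<And>a b. a \<in> periods D \<Longrightarrow> b \<in> periods D \<Longrightarrow> a - b \<in> periods D"
    and finite_elements: "finite (elements D)"
    and ref_elem: "\<And>e. e \<in> elements D \<Longrightarrow>
      compact (ref_elem D e) \<and> interior (ref_elem D e) \<noteq> {}"
    and elem_map: "\<And>e. e \<in> elements D \<Longrightarrow> continuous_on (ref_elem D e) (elem_map D e)"
    and elements_cover: "(\<Union>e\<in>elements D. elem_set D e) = closure (Omega D)"
    and elements_nonoverlapping: "\<And>e e' a. \<lbrakk>e \<in> elements D; e' \<in> elements D;
        a \<in> periods D; (e, 0) \<noteq> (e', a)\<rbrakk> \<Longrightarrow>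
      interior (elem_set D e) \<inter> (+) a ` interior (elem_set D e') = {}"
    and finite_mortars: "finite (mortars D)"
    and ref_mortar: "\<And>g. g \<in> mortars D \<Longrightarrow> \<exists>a b. a < b \<and> ref_mortar D g = {a..b}"
    and mortar_map: "\<And>g. g \<in> mortars D \<Longrightarrow> mortar_map D g differentiable_on ref_mortar D g"
    and mortars_cover:
      "(\<Union>a\<in>periods D. (+) a ` (\<Union>g\<in>mortars D. mortar_set D g)) =
       (\<Union>a\<in>periods D. (+) a ` (\<Union>e\<in>elements D. frontier (elem_set D e)))"
    and mortars_nonoverlapping: "\<And>g g' a. \<lbrakk>g \<in> mortars D; g' \<in> mortars D;
        a \<in> periods D; (g, 0) \<noteq> (g', a)\<rbrakk> \<Longrightarrow>
      open_mortar_set D g \<inter> (+) a ` open_mortar_set D g' = {}"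
    and mortar_meets_at_most_two: "\<And>g. g \<in> mortars D \<Longrightarrow> card (connected_elems D g) \<le> 2"
    and boundary_conditions: "periods D = {0} \<or> (\<forall>g\<in>mortars D. interior_mortar D g)"
    and basis_differentiable: "\<And>e k i. \<lbrakk>e \<in> elements D; k < dim_V D e; i < num_nodes D e\<rbrakk> \<Longrightarrow>
      basis_fun D e k differentiable (at (node D e i) within ref_elem D e)"
    and basis_independent: "\<And>e c. \<lbrakk>e \<in> elements D;
        \<And>\<xi>. \<xi> \<in> ref_elem D e \<Longrightarrow> (\<Sum>k<dim_V D e. c k * basis_fun D e k \<xi>) = 0\<rbrakk> \<Longrightarrow>
      \<forall>k<dim_V D e. c k = (0 :: real)"
    and quadrature: "\<And>e i. \<lbrakk>e \<in> elements D; i < num_nodes D e\<rbrakk> \<Longrightarrow>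
      node D e i \<in> ref_elem D e \<and> weight D e i > 0"
    and elem_map_differentiable: "\<And>e i. \<lbrakk>e \<in> elements D; i < num_nodes D e\<rbrakk> \<Longrightarrow>
      elem_map D e differentiable (at (node D e i) within ref_elem D e)"
    and mortar_quadrature: "\<And>g i. \<lbrakk>g \<in> mortars D; i < num_mortar_nodes D g\<rbrakk> \<Longrightarrow>
      mortar_node D g i \<in> ref_mortar D g \<and> mortar_weight D g i > 0"
    and trace_map_frontier: "\<And>e g. \<lbrakk>e \<in> elements D; g \<in> elem_mortars D e\<rbrakk> \<Longrightarrow>
      trace_map D e g ` ref_mortar D g \<subseteq> frontier (ref_elem D e)"
    and trace_map: "\<And>e g. \<lbrakk>e \<in> elements D; g \<in> elem_mortars D e\<rbrakk> \<Longrightarrow>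
      \<exists>a\<in>periods D. \<forall>\<xi>\<in>ref_mortar D g.
        elem_map D e (trace_map D e g \<xi>) = a + mortar_map D g \<xi>"
    and normal: "\<And>e g. \<lbrakk>e \<in> elements D; g \<in> elem_mortars D e\<rbrakk> \<Longrightarrow>
      outward_unit_normal D e g (normal D e g)"
    and normal_opposite: "\<And>e e' g \<xi>. \<lbrakk>g \<in> mortars D; e \<in> connected_elems D g;
        e' \<in> connected_elems D g; e \<noteq> e'; \<xi> \<in> ref_mortar D g\<rbrakk> \<Longrightarrow>
      normal D e' g \<xi> = - normal D e g \<xi>"


text \<open>Derivatives are taken within the reference element, as nodes may lie on its boundary.\<close>

definition d_r :: "(real \<times> real) set \<Rightarrow> (real \<times> real \<Rightarrow> 'b::real_normed_vector) \<Rightarrow> real \<times> real \<Rightarrow> 'b"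
  where "d_r S f \<xi> = frechet_derivative f (at \<xi> within S) (1, 0)"

definition d_s :: "(real \<times> real) set \<Rightarrow> (real \<times> real \<Rightarrow> 'b::real_normed_vector) \<Rightarrow> real \<times> real \<Rightarrow> 'b"
  where "d_s S f \<xi> = frechet_derivative f (at \<xi> within S) (0, 1)"

definition jacobian_det :: "('e, 'g) discretization \<Rightarrow> 'e \<Rightarrow> real \<times> real \<Rightarrow> real" where
  "jacobian_det D e \<xi> =
     (let X_r = d_r (ref_elem D e) (elem_map D e) \<xi>; X_s = d_s (ref_elem D e) (elem_map D e) \<xi>
      in fst X_r * snd X_s - fst X_s * snd X_r)"

definition W_mat :: "('e, 'g) discretization \<Rightarrow> 'e \<Rightarrow> real mat" where
  "W_mat D e = mat_diag (num_nodes D e) (weight D e)"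

definition J_mat :: "('e, 'g) discretization \<Rightarrow> 'e \<Rightarrow> real mat" where
  "J_mat D e = mat_diag (num_nodes D e) (\<lambda>i. jacobian_det D e (node D e i))"

definition L_mat :: "('e, 'g) discretization \<Rightarrow> 'e \<Rightarrow> real mat" where
  "L_mat D e = Matrix.mat (num_nodes D e) (dim_V D e) (\<lambda>(i, k). basis_fun D e k (node D e i))"

definition Dr_mat :: "('e, 'g) discretization \<Rightarrow> 'e \<Rightarrow> real mat" where
  "Dr_mat D e = Matrix.mat (num_nodes D e) (dim_V D e)
     (\<lambda>(i, k). d_r (ref_elem D e) (basis_fun D e k) (node D e i))"

definition Ds_mat :: "('e, 'g) discretization \<Rightarrow> 'e \<Rightarrow> real mat" where
  "Ds_mat D e = Matrix.mat (num_nodes D e) (dim_V D e)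
     (\<lambda>(i, k). d_s (ref_elem D e) (basis_fun D e k) (node D e i))"

definition MJ :: "('e, 'g) discretization \<Rightarrow> 'e \<Rightarrow> real mat" where
  "MJ D e = transpose_mat (L_mat D e) * W_mat D e * J_mat D e * L_mat D e"

definition Sx :: "('e, 'g) discretization \<Rightarrow> 'e \<Rightarrow> real mat" where
  "Sx D e = transpose_mat (L_mat D e) * W_mat D e * J_mat D e *
     (mat_diag (num_nodes D e) (metric_rx D e) * Dr_mat D e +
      mat_diag (num_nodes D e) (metric_sx D e) * Ds_mat D e)"

definition Sy :: "('e, 'g) discretization \<Rightarrow> 'e \<Rightarrow> real mat" where
  "Sy D e = transpose_mat (L_mat D e) * W_mat D e * J_mat D e *
     (mat_diag (num_nodes D e) (metric_ry D e) * Dr_mat D e +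
      mat_diag (num_nodes D e) (metric_sy D e) * Ds_mat D e)"

definition sym_pos_def :: "real mat \<Rightarrow> bool" where
  "sym_pos_def A \<longleftrightarrow> square_mat A \<and> transpose_mat A = A \<and>
     (\<forall>x\<in>carrier_vec (dim_row A). x \<noteq> 0\<^sub>v (dim_row A) \<longrightarrow> scalar_prod x (A *\<^sub>v x) > 0)"


definition Lg :: "('e, 'g) discretization \<Rightarrow> 'e \<Rightarrow> 'g \<Rightarrow> real mat" where
  "Lg D e g = Matrix.mat (num_mortar_nodes D g) (dim_V D e)
     (\<lambda>(i, k). basis_fun D e k (trace_map D e g (mortar_node D g i)))"

definition Wg :: "('e, 'g) discretization \<Rightarrow> 'g \<Rightarrow> real mat" where
  "Wg D g = mat_diag (num_mortar_nodes D g) (mortar_weight D g)"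

definition SJg :: "('e, 'g) discretization \<Rightarrow> 'g \<Rightarrow> real mat" where
  "SJg D g = mat_diag (num_mortar_nodes D g) (\<lambda>i. norm (mortar_tangent D g (mortar_node D g i)))"

definition nx :: "('e, 'g) discretization \<Rightarrow> 'e \<Rightarrow> 'g \<Rightarrow> real mat" where
  "nx D e g = mat_diag (num_mortar_nodes D g) (\<lambda>i. fst (normal D e g (mortar_node D g i)))"

definition ny :: "('e, 'g) discretization \<Rightarrow> 'e \<Rightarrow> 'g \<Rightarrow> real mat" where
  "ny D e g = mat_diag (num_mortar_nodes D g) (\<lambda>i. snd (normal D e g (mortar_node D g i)))"


text \<open>Here \<open>p\<close>, \<open>vx\<close>, \<open>vy\<close> assign to each element its coefficient vector at a fixed time.\<close>

definition p_minus :: "('e, 'g) discretization \<Rightarrow> ('e \<Rightarrow> real vec) \<Rightarrow> 'e \<Rightarrow> 'g \<Rightarrow> real vec" where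
  "p_minus D p e g = Lg D e g *\<^sub>v p e"

definition vn_minus ::
  "('e, 'g) discretization \<Rightarrow> ('e \<Rightarrow> real vec) \<Rightarrow> ('e \<Rightarrow> real vec) \<Rightarrow> 'e \<Rightarrow> 'g \<Rightarrow> real vec" where
  "vn_minus D vx vy e g = nx D e g *\<^sub>v (Lg D e g *\<^sub>v vx e) + ny D e g *\<^sub>v (Lg D e g *\<^sub>v vy e)"

definition p_plus :: "('e, 'g) discretization \<Rightarrow> ('e \<Rightarrow> real vec) \<Rightarrow> 'e \<Rightarrow> 'g \<Rightarrow> real vec" where
  "p_plus D p e g =
     (if interior_mortar D g
      then let e' = other_elem D e g in Lg D e' g *\<^sub>v p e'
      else p_minus D p e g)"

definition vn_plus ::
  "('e, 'g) discretization \<Rightarrow> ('e \<Rightarrow> real vec) \<Rightarrow> ('e \<Rightarrow> real vec) \<Rightarrow> 'e \<Rightarrow> 'g \<Rightarrow> real vec" where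
  "vn_plus D vx vy e g =
     (if interior_mortar D g
      then let e' = other_elem D e g
           in nx D e g *\<^sub>v (Lg D e' g *\<^sub>v vx e') + ny D e g *\<^sub>v (Lg D e' g *\<^sub>v vy e')
      else - vn_minus D vx vy e g)"

definition p_star ::
  "('e, 'g) discretization \<Rightarrow> real \<Rightarrow> ('e \<Rightarrow> real vec) \<Rightarrow> ('e \<Rightarrow> real vec) \<Rightarrow> ('e \<Rightarrow> real vec) \<Rightarrow>
    'e \<Rightarrow> 'g \<Rightarrow> real vec" where
  "p_star D \<alpha> p vx vy e g =
     (1/2) \<cdot>\<^sub>v (p_plus D p e g + p_minus D p e g)
     - (\<alpha>/2) \<cdot>\<^sub>v (vn_plus D vx vy e g - vn_minus D vx vy e g)"

definition vn_star ::
  "('e, 'g) discretization \<Rightarrow> real \<Rightarrow> ('e \<Rightarrow> real vec) \<Rightarrow> ('e \<Rightarrow> real vec) \<Rightarrow> ('e \<Rightarrow> real vec) \<Rightarrow>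
    'e \<Rightarrow> 'g \<Rightarrow> real vec" where
  "vn_star D \<alpha> p vx vy e g =
     (1/2) \<cdot>\<^sub>v (vn_plus D vx vy e g + vn_minus D vx vy e g)
     - (\<alpha>/2) \<cdot>\<^sub>v (p_plus D p e g - p_minus D p e g)"


text \<open>\<open>f' = df/dt\<close> at time \<open>t \<ge> 0\<close>, componentwise (one-sided at \<open>t = 0\<close>).\<close>

definition has_time_derivative :: "(real \<Rightarrow> real vec) \<Rightarrow> real vec \<Rightarrow> real \<Rightarrow> bool" where
  "has_time_derivative f f' t \<longleftrightarrow> dim_vec f' = dim_vec (f t) \<and>
     (\<forall>k<dim_vec f'. ((\<lambda>\<tau>. f \<tau> $ k) has_real_derivative f' $ k) (at t within {0..}))"

definition scheme_solution ::
  "('e, 'g) discretization \<Rightarrow> real \<Rightarrow> (real \<Rightarrow> 'e \<Rightarrow> real vec) \<Rightarrow> (real \<Rightarrow> 'e \<Rightarrow> real vec) \<Rightarrow>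
    (real \<Rightarrow> 'e \<Rightarrow> real vec) \<Rightarrow> bool" where
  "scheme_solution D \<alpha> p vx vy \<longleftrightarrow>
     (\<forall>t\<ge>0. \<forall>e\<in>elements D.
        p t e \<in> carrier_vec (dim_V D e) \<and>
        vx t e \<in> carrier_vec (dim_V D e) \<and>
        vy t e \<in> carrier_vec (dim_V D e) \<and>
        (\<exists>dp dvx dvy.
          has_time_derivative (\<lambda>\<tau>. p \<tau> e) dp t \<and>
          has_time_derivative (\<lambda>\<tau>. vx \<tau> e) dvx t \<and>
          has_time_derivative (\<lambda>\<tau>. vy \<tau> e) dvy t \<and>
          MJ D e *\<^sub>v dp + Sx D e *\<^sub>v vx t e + Sy D e *\<^sub>v vy t e =
            - finsum_vec TYPE(real) (dim_V D e)
                (\<lambda>g. (transpose_mat (Lg D e g) * SJg D g * Wg D g) *\<^sub>v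
                   (vn_star D \<alpha> (p t) (vx t) (vy t) e g - vn_minus D (vx t) (vy t) e g))
                (elem_mortars D e) \<and>
          MJ D e *\<^sub>v dvx - transpose_mat (Sx D e) *\<^sub>v p t e =
            - finsum_vec TYPE(real) (dim_V D e)
                (\<lambda>g. (transpose_mat (Lg D e g) * nx D e g * SJg D g * Wg D g) *\<^sub>v
                   p_star D \<alpha> (p t) (vx t) (vy t) e g)
                (elem_mortars D e) \<and>
          MJ D e *\<^sub>v dvy - transpose_mat (Sy D e) *\<^sub>v p t e =
            - finsum_vec TYPE(real) (dim_V D e)
                (\<lambda>g. (transpose_mat (Lg D e g) * ny D e g * SJg D g * Wg D g) *\<^sub>v
                   p_star D \<alpha> (p t) (vx t) (vy t) e g)
                (elem_mortars D e)))"

definition elem_energy ::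
  "('e, 'g) discretization \<Rightarrow> ('e \<Rightarrow> real vec) \<Rightarrow> ('e \<Rightarrow> real vec) \<Rightarrow> ('e \<Rightarrow> real vec) \<Rightarrow> 'e \<Rightarrow> real"
  where
  "elem_energy D p vx vy e =
     (scalar_prod (p e) (MJ D e *\<^sub>v p e) + scalar_prod (vx e) (MJ D e *\<^sub>v vx e)
      + scalar_prod (vy e) (MJ D e *\<^sub>v vy e)) / 2"

definition energy ::
  "('e, 'g) discretization \<Rightarrow> ('e \<Rightarrow> real vec) \<Rightarrow> ('e \<Rightarrow> real vec) \<Rightarrow> ('e \<Rightarrow> real vec) \<Rightarrow> real" where
  "energy D p vx vy = (\<Sum>e\<in>elements D. elem_energy D p vx vy e)"

end

theory Submission
  imports Defs
begin

text \<open>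
  The energy can only leave the mesh through the fluxes.  Test the pressure equation with \<open>p\<close> and
  the velocity equations with \<open>v\<^sub>x\<close> and \<open>v\<^sub>y\<close>.  As \<open>M\<^sub>J\<close> is symmetric, the time derivatives add up
  to that of the energy of the element.  The velocity equations contain the exact transposes of
  the matrices in the pressure equation, so the volume terms cancel (\<open>elem_energy_balance\<close>) and
  a quadrature sum over the mortar nodes remains, with integrand
  \<open>p\<^sup>- (v\<^sub>n\<^sup>* - v\<^sub>n\<^sup>-) + v\<^sub>n\<^sup>- p\<^sup>* = (p\<^sup>- v\<^sub>n\<^sup>+ + v\<^sub>n\<^sup>- p\<^sup>+) / 2
    + \<alpha>/2 (p\<^sup>- (p\<^sup>- - p\<^sup>+) + v\<^sub>n\<^sup>- (v\<^sub>n\<^sup>- - v\<^sub>n\<^sup>+))\<close>.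

  Now collect the contributions mortar by mortar (\<open>mortar_power_nonneg\<close>).  Two elements that share
  a mortar see the same nodes and weights, exchange the roles of \<open>p\<^sup>-\<close> and \<open>p\<^sup>+\<close>, and, since their
  normals are opposite, exchange \<open>v\<^sub>n\<^sup>-\<close> and \<open>v\<^sub>n\<^sup>+\<close> with a change of sign.  The central terms of the
  pair cancel and the penalty terms form \<open>\<alpha>/2\<close> times a sum of two squares.  On a boundary mortar
  the mirrored state leaves \<open>\<alpha> (v\<^sub>n\<^sup>-)\<^sup>2\<close>.  Hence the total power lost is nonnegative
  (\<open>total_flux_power_nonneg\<close>), and the energy, being differentiable with nonpositive derivative,
  is nonincreasing.
\<close>

(* $ below always selects a component of a vector of variable dimension. *)
no_notation vec_nth (infixl \<open>$\<close> 90)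

section \<open>Scalar products with the matrices of the scheme\<close>

lemma scalar_prod_finsum_vec:
  fixes F :: "'c \<Rightarrow> real vec"
  assumes "finite A" "x \<in> carrier_vec n" "F \<in> A \<rightarrow> carrier_vec n"
  shows "scalar_prod x (finsum_vec TYPE(real) n F A) = (\<Sum>g\<in>A. scalar_prod x (F g))"
proof -
  have dim: "dim_vec (finsum_vec TYPE(real) n F A) = n"
    using finsum_vec_closed[OF assms(3)] by simp
  have "scalar_prod x (finsum_vec TYPE(real) n F A) = (\<Sum>i<n. \<Sum>g\<in>A. x $ i * F g $ i)"
    unfolding scalar_prod_def dim
    by (auto simp: index_finsum_vec[OF assms(1) _ assms(3)] sum_distrib_left
        lessThan_atLeast0 intro!: sum.cong)
  also have "\<dots> = (\<Sum>g\<in>A. \<Sum>i<n. x $ i * F g $ i)"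
    by (rule sum.swap)
  also have "\<dots> = (\<Sum>g\<in>A. scalar_prod x (F g))"
    using assms(3) by (intro sum.cong refl) (auto simp: scalar_prod_def lessThan_atLeast0 Pi_iff)
  finally show ?thesis .
qed

lemma scalar_prod_transpose_mult_vec:
  fixes A :: "real mat"
  assumes "A \<in> carrier_mat m n" "x \<in> carrier_vec n" "y \<in> carrier_vec m"
  shows "scalar_prod x (transpose_mat A *\<^sub>v y) = scalar_prod y (A *\<^sub>v x)"
proof -
  have "scalar_prod x (transpose_mat A *\<^sub>v y) = scalar_prod (transpose_mat A *\<^sub>v y) x"
    by (rule comm_scalar_prod[of _ n]) (use assms in auto)
  then show ?thesis
    using transpose_vec_mult_scalar[OF assms] by simp
qed

lemma mat_diag_mult_vec_index:
  fixes f :: "nat \<Rightarrow> real"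
  assumes "y \<in> carrier_vec n" "i < n"
  shows "(mat_diag n f *\<^sub>v y) $ i = f i * y $ i"
proof -
  have "(mat_diag n f *\<^sub>v y) $ i = (\<Sum>j\<in>{0..<n}. (if i = j then f j else 0) * y $ j)"
    using assms by (auto simp: mat_diag_def scalar_prod_def intro!: sum.cong)
  also have "\<dots> = (\<Sum>j\<in>{0..<n}. if i = j then f j * y $ j else 0)"
    by (intro sum.cong) auto
  finally show ?thesis using assms by simp
qed

text \<open>
  With \<open>A\<close> a trace matrix \<open>L\<^sup>g\<close>, this turns a flux term of the scheme, tested with the solution,
  into a quadrature sum over \<open>g\<close>, so that the two sides of \<open>g\<close> can be compared node by node.
\<close>

lemma scalar_prod_lift_mult_vec:
  fixes A :: "real mat"
  assumes A: "A \<in> carrier_mat m n" and x: "x \<in> carrier_vec n" and y: "y \<in> carrier_vec m"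
  shows "scalar_prod x ((transpose_mat A * mat_diag m f) *\<^sub>v y)
    = (\<Sum>i<m. f i * (A *\<^sub>v x) $ i * y $ i)"
proof -
  have D: "mat_diag m f *\<^sub>v y \<in> carrier_vec m"
    by (rule mult_mat_vec_carrier[OF mat_diag_dim y])
  have "scalar_prod x ((transpose_mat A * mat_diag m f) *\<^sub>v y)
      = scalar_prod x (transpose_mat A *\<^sub>v (mat_diag m f *\<^sub>v y))"
    by (subst assoc_mult_mat_vec[OF _ mat_diag_dim y, of _ n]) (use A in auto)
  also have "\<dots> = scalar_prod (mat_diag m f *\<^sub>v y) (A *\<^sub>v x)"
    by (rule scalar_prod_transpose_mult_vec[OF A x D])
  also have "\<dots> = (\<Sum>i<m. f i * (A *\<^sub>v x) $ i * y $ i)"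
    using A y by (auto simp: scalar_prod_def[of _ "A *\<^sub>v x"] lessThan_atLeast0
        mat_diag_mult_vec_index simp del: index_mult_mat_vec intro!: sum.cong)
  finally show ?thesis .
qed

lemma mult_mat_diag_mat_diag:
  fixes B :: "real mat"
  assumes "B \<in> carrier_mat n m"
  shows "B * mat_diag m f * mat_diag m g = B * mat_diag m (\<lambda>i. f i * g i)"
  using assoc_mult_mat[OF assms mat_diag_dim mat_diag_dim] by simp


section \<open>Time derivative of a quadratic form\<close>

lemma has_real_derivative_quadratic_form:
  fixes A :: "real mat"
  assumes A: "A \<in> carrier_mat n n" "transpose_mat A = A"
    and f: "\<And>\<tau>. \<tau> \<ge> 0 \<Longrightarrow> f \<tau> \<in> carrier_vec n"
    and f': "has_time_derivative f f' t" and t: "t \<ge> 0"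
  shows "((\<lambda>\<tau>. scalar_prod (f \<tau>) (A *\<^sub>v f \<tau>)) has_real_derivative
    2 * scalar_prod (f t) (A *\<^sub>v f')) (at t within {0..})"
proof -
  have n: "dim_vec f' = n"
    using f' f[OF t] by (simp add: has_time_derivative_def)
  then have f'_carrier: "f' \<in> carrier_vec n"
    by (rule carrier_vecI)
  have form: "scalar_prod x (A *\<^sub>v y) = (\<Sum>i<n. \<Sum>j<n. x $ i * (A $$ (i, j) * y $ j))"
    if "x \<in> carrier_vec n" "y \<in> carrier_vec n" for x y
    using A(1) that by (auto simp: scalar_prod_def sum_distrib_left lessThan_atLeast0
        intro!: sum.cong)
  have c: "((\<lambda>\<tau>. f \<tau> $ k) has_real_derivative f' $ k) (at t within {0..})" if "k < n" for k
    using f' n that by (simp add: has_time_derivative_def)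
  have deriv: "((\<lambda>\<tau>. \<Sum>i<n. \<Sum>j<n. f \<tau> $ i * (A $$ (i, j) * f \<tau> $ j)) has_real_derivative
      (\<Sum>i<n. \<Sum>j<n. f' $ i * (A $$ (i, j) * f t $ j) + f t $ i * (A $$ (i, j) * f' $ j)))
      (at t within {0..})"
    by (intro DERIV_sum) (auto intro!: derivative_eq_intros c)
  have "(\<Sum>i<n. \<Sum>j<n. f' $ i * (A $$ (i, j) * f t $ j) + f t $ i * (A $$ (i, j) * f' $ j))
      = scalar_prod f' (A *\<^sub>v f t) + scalar_prod (f t) (A *\<^sub>v f')"
    by (simp only: form[OF f'_carrier f[OF t]] form[OF f[OF t] f'_carrier] sum.distrib)
  also have "scalar_prod f' (A *\<^sub>v f t) = scalar_prod (f t) (A *\<^sub>v f')"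
    using scalar_prod_transpose_mult_vec[OF A(1) f'_carrier f[OF t]] by (simp only: A(2))
  finally have "((\<lambda>\<tau>. \<Sum>i<n. \<Sum>j<n. f \<tau> $ i * (A $$ (i, j) * f \<tau> $ j)) has_real_derivative
      2 * scalar_prod (f t) (A *\<^sub>v f')) (at t within {0..})"
    by (intro DERIV_cong[OF deriv]) (simp only: mult_2)
  then show ?thesis
    \<comment> \<open>The expansion into components is valid for nonnegative times, where the dimension is \<open>n\<close>.\<close>
    by (rule has_field_derivative_transform_within[where d = 1])
       (use t f in \<open>simp_all add: form\<close>)
qed


section \<open>Energy balance on one element\<close>

lemma dim_col_volume_matrices [simp]:
  "dim_col (L_mat D e) = dim_V D e" "dim_col (Dr_mat D e) = dim_V D e"
  "dim_col (Ds_mat D e) = dim_V D e"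
  by (simp_all add: L_mat_def Dr_mat_def Ds_mat_def)

lemma MJ_carrier: "MJ D e \<in> carrier_mat (dim_V D e) (dim_V D e)"
  unfolding MJ_def by (rule carrier_matI) simp_all

lemma Sx_carrier: "Sx D e \<in> carrier_mat (dim_V D e) (dim_V D e)"
  unfolding Sx_def by (rule carrier_matI) simp_all

lemma Sy_carrier: "Sy D e \<in> carrier_mat (dim_V D e) (dim_V D e)"
  unfolding Sy_def by (rule carrier_matI) simp_all

lemma Lg_carrier: "Lg D e g \<in> carrier_mat (num_mortar_nodes D g) (dim_V D e)"
  by (simp add: Lg_def)

lemma dim_row_mortar_matrices [simp]:
  "dim_row (Lg D e g) = num_mortar_nodes D g"
  "dim_row (nx D e g) = num_mortar_nodes D g"
  "dim_row (ny D e g) = num_mortar_nodes D g"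
  by (simp_all add: Lg_def nx_def ny_def mat_diag_def)

lemma dim_minus_plus [simp]:
  "dim_vec (p_minus D p e g) = num_mortar_nodes D g"
  "dim_vec (vn_minus D vx vy e g) = num_mortar_nodes D g"
  "dim_vec (p_plus D p e g) = num_mortar_nodes D g"
  "dim_vec (vn_plus D vx vy e g) = num_mortar_nodes D g"
  by (auto simp: p_minus_def vn_minus_def p_plus_def vn_plus_def Let_def)

lemma dim_star [simp]:
  "dim_vec (p_star D \<alpha> p vx vy e g) = num_mortar_nodes D g"
  "dim_vec (vn_star D \<alpha> p vx vy e g) = num_mortar_nodes D g"
  by (auto simp: p_star_def vn_star_def)

lemma normal_matrix_mult_index:
  assumes "y \<in> carrier_vec (num_mortar_nodes D g)" "i < num_mortar_nodes D g"
  shows "(nx D e g *\<^sub>v y) $ i = fst (normal D e g (mortar_node D g i)) * y $ i"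
    and "(ny D e g *\<^sub>v y) $ i = snd (normal D e g (mortar_node D g i)) * y $ i"
  unfolding nx_def ny_def by (rule mat_diag_mult_vec_index[OF assms])+

lemma Lg_mult_carrier: "Lg D e g *\<^sub>v x \<in> carrier_vec (num_mortar_nodes D g)"
  by (rule carrier_vecI) simp

lemma vn_minus_index:
  assumes "i < num_mortar_nodes D g"
  shows "vn_minus D vx vy e g $ i =
    fst (normal D e g (mortar_node D g i)) * (Lg D e g *\<^sub>v vx e) $ i +
    snd (normal D e g (mortar_node D g i)) * (Lg D e g *\<^sub>v vy e) $ i"
  using assms
  by (simp add: vn_minus_def normal_matrix_mult_index Lg_mult_carrier del: index_mult_mat_vec)

definition mortar_quad_weight :: "('e, 'g) discretization \<Rightarrow> 'g \<Rightarrow> nat \<Rightarrow> real" where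
  "mortar_quad_weight D g i =
     norm (mortar_tangent D g (mortar_node D g i)) * mortar_weight D g i"

text \<open>
  The power leaving \<open>e\<close> through \<open>g\<close>: minus the contribution of \<open>g\<close> to the three right-hand
  sides of the scheme, tested with \<open>p\<close>, \<open>vx\<close>, \<open>vy\<close>.  The two velocity equations together
  produce the factor \<open>v\<^sub>n\<^sup>-\<close>.
\<close>

definition flux_power ::
  "('e, 'g) discretization \<Rightarrow> real \<Rightarrow> ('e \<Rightarrow> real vec) \<Rightarrow> ('e \<Rightarrow> real vec) \<Rightarrow> ('e \<Rightarrow> real vec) \<Rightarrow>
    'e \<Rightarrow> 'g \<Rightarrow> real" where
  "flux_power D \<alpha> p vx vy e g = (\<Sum>i<num_mortar_nodes D g. mortar_quad_weight D g i *
     (p_minus D p e g $ i * (vn_star D \<alpha> p vx vy e g $ i - vn_minus D vx vy e g $ i) +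
      vn_minus D vx vy e g $ i * p_star D \<alpha> p vx vy e g $ i))"

lemma flux_power_eq_tested_rhs:
  assumes p: "p e \<in> carrier_vec (dim_V D e)" and vx: "vx e \<in> carrier_vec (dim_V D e)"
    and vy: "vy e \<in> carrier_vec (dim_V D e)"
  shows "scalar_prod (p e) ((transpose_mat (Lg D e g) * SJg D g * Wg D g) *\<^sub>v
        (vn_star D \<alpha> p vx vy e g - vn_minus D vx vy e g))
    + scalar_prod (vx e) ((transpose_mat (Lg D e g) * nx D e g * SJg D g * Wg D g) *\<^sub>v
        p_star D \<alpha> p vx vy e g)
    + scalar_prod (vy e) ((transpose_mat (Lg D e g) * ny D e g * SJg D g * Wg D g) *\<^sub>v
        p_star D \<alpha> p vx vy e g)
    = flux_power D \<alpha> p vx vy e g"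
proof -
  let ?m = "num_mortar_nodes D g"
  note diag = mult_mat_diag_mat_diag[of "transpose_mat (Lg D e g)" "dim_V D e" ?m]
  have LT: "transpose_mat (Lg D e g) \<in> carrier_mat (dim_V D e) ?m"
    using Lg_carrier[of D e g] by simp
  have v: "vn_star D \<alpha> p vx vy e g - vn_minus D vx vy e g \<in> carrier_vec ?m"
    by (rule carrier_vecI) simp
  have s: "p_star D \<alpha> p vx vy e g \<in> carrier_vec ?m"
    by (rule carrier_vecI) simp
  show ?thesis
    unfolding SJg_def Wg_def nx_def ny_def diag[OF LT]
      scalar_prod_lift_mult_vec[OF Lg_carrier p v]
      scalar_prod_lift_mult_vec[OF Lg_carrier vx s]
      scalar_prod_lift_mult_vec[OF Lg_carrier vy s]
      flux_power_def sum.distrib[symmetric]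
    by (intro sum.cong refl)
       (simp add: p_minus_def vn_minus_index mortar_quad_weight_def algebra_simps
         del: index_mult_mat_vec)
qed

text \<open>
  \<open>p\<^sup>T S\<^sub>x v\<^sub>x\<close> from the pressure equation and \<open>v\<^sub>x\<^sup>T S\<^sub>x\<^sup>T p\<close> from the velocity equation are the same
  number with opposite signs, so the volume terms cancel algebraically and only the fluxes
  change the energy of an element.
\<close>

lemma elem_energy_balance:
  assumes fin: "finite G"
    and p: "p e \<in> carrier_vec (dim_V D e)" and vx: "vx e \<in> carrier_vec (dim_V D e)"
    and vy: "vy e \<in> carrier_vec (dim_V D e)"
    and dp: "dp \<in> carrier_vec (dim_V D e)" and dvx: "dvx \<in> carrier_vec (dim_V D e)"
    and dvy: "dvy \<in> carrier_vec (dim_V D e)"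
    and eq_p: "MJ D e *\<^sub>v dp + Sx D e *\<^sub>v vx e + Sy D e *\<^sub>v vy e =
            - finsum_vec TYPE(real) (dim_V D e)
                (\<lambda>g. (transpose_mat (Lg D e g) * SJg D g * Wg D g) *\<^sub>v
                   (vn_star D \<alpha> p vx vy e g - vn_minus D vx vy e g)) G"
    and eq_vx: "MJ D e *\<^sub>v dvx - transpose_mat (Sx D e) *\<^sub>v p e =
            - finsum_vec TYPE(real) (dim_V D e)
                (\<lambda>g. (transpose_mat (Lg D e g) * nx D e g * SJg D g * Wg D g) *\<^sub>v
                   p_star D \<alpha> p vx vy e g) G"
    and eq_vy: "MJ D e *\<^sub>v dvy - transpose_mat (Sy D e) *\<^sub>v p e =
            - finsum_vec TYPE(real) (dim_V D e)
                (\<lambda>g. (transpose_mat (Lg D e g) * ny D e g * SJg D g * Wg D g) *\<^sub>v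
                   p_star D \<alpha> p vx vy e g) G"
  shows "scalar_prod (p e) (MJ D e *\<^sub>v dp) + scalar_prod (vx e) (MJ D e *\<^sub>v dvx)
      + scalar_prod (vy e) (MJ D e *\<^sub>v dvy) = - (\<Sum>g\<in>G. flux_power D \<alpha> p vx vy e g)"
proof -
  let ?n = "dim_V D e"
  have tested_sum: "scalar_prod x (- finsum_vec TYPE(real) ?n (\<lambda>g. B g *\<^sub>v y g) G)
      = - (\<Sum>g\<in>G. scalar_prod x (B g *\<^sub>v y g))"
    if x: "x \<in> carrier_vec ?n" and B: "\<And>g. dim_row (B g) = ?n" for x B y
  proof -
    have F: "(\<lambda>g. B g *\<^sub>v y g) \<in> G \<rightarrow> carrier_vec ?n"
      using B by (auto intro!: carrier_vecI)
    show ?thesis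
      using scalar_prod_finsum_vec[OF fin x F] finsum_vec_closed[OF F] x by simp
  qed
  have M: "MJ D e *\<^sub>v x \<in> carrier_vec ?n" "Sx D e *\<^sub>v x \<in> carrier_vec ?n"
    "Sy D e *\<^sub>v x \<in> carrier_vec ?n" "transpose_mat (Sx D e) *\<^sub>v x \<in> carrier_vec ?n"
    "transpose_mat (Sy D e) *\<^sub>v x \<in> carrier_vec ?n" for x
    using MJ_carrier[of D e] Sx_carrier[of D e] Sy_carrier[of D e]
    by (auto intro!: carrier_vecI)
  have dimL: "dim_col (Lg D e g) = ?n" for g
    by (simp add: Lg_def)
  have "scalar_prod (p e) (MJ D e *\<^sub>v dp) + scalar_prod (p e) (Sx D e *\<^sub>v vx e)
      + scalar_prod (p e) (Sy D e *\<^sub>v vy e)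
      = scalar_prod (p e) (MJ D e *\<^sub>v dp + Sx D e *\<^sub>v vx e + Sy D e *\<^sub>v vy e)"
    using M p by (simp add: scalar_prod_add_distrib[of _ ?n] del: assoc_add_vec)
  moreover have "scalar_prod (vx e) (MJ D e *\<^sub>v dvx) - scalar_prod (p e) (Sx D e *\<^sub>v vx e)
      = scalar_prod (vx e) (MJ D e *\<^sub>v dvx - transpose_mat (Sx D e) *\<^sub>v p e)"
    using M vx by (simp add: scalar_prod_minus_distrib[of _ ?n]
        scalar_prod_transpose_mult_vec[OF Sx_carrier vx p])
  moreover have "scalar_prod (vy e) (MJ D e *\<^sub>v dvy) - scalar_prod (p e) (Sy D e *\<^sub>v vy e)
      = scalar_prod (vy e) (MJ D e *\<^sub>v dvy - transpose_mat (Sy D e) *\<^sub>v p e)"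
    using M vy by (simp add: scalar_prod_minus_distrib[of _ ?n]
        scalar_prod_transpose_mult_vec[OF Sy_carrier vy p])
  ultimately show ?thesis
    unfolding eq_p eq_vx eq_vy
    by (simp add: tested_sum p vx vy dimL sum.distrib
        flux_power_eq_tested_rhs[of p e D vx vy, OF p vx vy, symmetric])
qed


section \<open>Dissipation on the mortar\<close>

text \<open>
  Both kinds of mortar have the same form once the outer state is expressed by the data
  \<open>(p\<^sup>-, v\<^sub>n\<^sup>-)\<close> of an element \<open>e'\<close> measured with the normal of \<open>e'\<close>: on a boundary mortar
  \<open>e' = e\<close>, and on an interior mortar \<open>e'\<close> is the neighbour, whose opposite normal
  provides the sign.
\<close>

lemma flux_power_via_neighbour:
  assumes P: "p_plus D p e g = p_minus D p e' g"
    and V: "vn_plus D vx vy e g = - vn_minus D vx vy e' g"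
  shows "flux_power D \<alpha> p vx vy e g = (\<Sum>i<num_mortar_nodes D g. mortar_quad_weight D g i *
     (let a = p_minus D p e g $ i; v = vn_minus D vx vy e g $ i;
          b = p_minus D p e' g $ i; w = vn_minus D vx vy e' g $ i
      in (v * b - a * w) / 2 + \<alpha> / 2 * (a * (a - b) + v * (v + w))))"
  unfolding flux_power_def
  by (intro sum.cong refl arg_cong[where f = "\<lambda>x. _ * x"])
     (simp add: p_star_def vn_star_def P V Let_def field_simps)

lemma other_elem_eq:
  assumes "connected_elems D g = {e, e'}" "e \<noteq> e'"
  shows "other_elem D e g = e'"
  unfolding other_elem_def by (rule the_equality) (use assms in auto)

lemma (in dg_discretization) plus_interior:
  assumes g: "g \<in> mortars D" and con: "connected_elems D g = {e, e'}" and ne: "e \<noteq> e'"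
  shows "p_plus D p e g = p_minus D p e' g"
    and "vn_plus D vx vy e g = - vn_minus D vx vy e' g"
proof -
  have int: "interior_mortar D g"
    using con ne by (simp add: interior_mortar_def)
  note other = other_elem_eq[OF con ne]
  show "p_plus D p e g = p_minus D p e' g"
    by (simp add: p_plus_def p_minus_def int other Let_def)
  have opp: "normal D e' g (mortar_node D g i) = - normal D e g (mortar_node D g i)"
    if "i < num_mortar_nodes D g" for i
    using normal_opposite[OF g, of e e'] mortar_quadrature[OF g that] con ne by auto
  have "vn_plus D vx vy e g $ i =
      fst (normal D e g (mortar_node D g i)) * (Lg D e' g *\<^sub>v vx e') $ i +
      snd (normal D e g (mortar_node D g i)) * (Lg D e' g *\<^sub>v vy e') $ i"
    if "i < num_mortar_nodes D g" for i
    using that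
    by (simp add: vn_plus_def int other Let_def normal_matrix_mult_index Lg_mult_carrier
        del: index_mult_mat_vec)
  then show "vn_plus D vx vy e g = - vn_minus D vx vy e' g"
    by (intro eq_vecI) (auto simp: vn_minus_index opp simp del: index_mult_mat_vec)
qed

text \<open>
  On an interior mortar the central part of the power is antisymmetric in the two elements and
  cancels; the penalty parts add up to \<open>\<alpha>/2\<close> times the squared jumps of \<open>p\<close> and of the normal
  velocity.  On a boundary mortar the central part vanishes and \<open>\<alpha> (v\<^sub>n\<^sup>-)\<^sup>2\<close> remains.
\<close>

lemma (in dg_discretization) mortar_power_nonneg:
  assumes g: "g \<in> mortars D" and \<alpha>: "\<alpha> \<ge> 0"
  shows "(\<Sum>e\<in>connected_elems D g. flux_power D \<alpha> p vx vy e g) \<ge> 0"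
proof -
  have wt: "mortar_quad_weight D g i \<ge> 0" if "i < num_mortar_nodes D g" for i
    using mortar_quadrature[OF g that] by (simp add: mortar_quad_weight_def)
  show ?thesis
  proof (cases "interior_mortar D g")
    case True
    then obtain e e' where con: "connected_elems D g = {e, e'}" and ne: "e \<noteq> e'"
      by (auto simp: interior_mortar_def card_2_iff)
    then have con': "connected_elems D g = {e', e}" by auto
    have "(\<Sum>e\<in>connected_elems D g. flux_power D \<alpha> p vx vy e g)
        = flux_power D \<alpha> p vx vy e g + flux_power D \<alpha> p vx vy e' g"
      using con ne by simp
    also have "\<dots> = (\<Sum>i<num_mortar_nodes D g. mortar_quad_weight D g i * (\<alpha> / 2 *
        ((p_minus D p e g $ i - p_minus D p e' g $ i)\<^sup>2 +
         (vn_minus D vx vy e g $ i + vn_minus D vx vy e' g $ i)\<^sup>2)))"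
      unfolding flux_power_via_neighbour[OF plus_interior[OF g con ne]]
        flux_power_via_neighbour[OF plus_interior[OF g con' ne[symmetric]]]
        sum.distrib[symmetric] distrib_left[symmetric]
      by (intro sum.cong refl arg_cong[where f = "\<lambda>x. _ * x"])
         (simp add: Let_def power2_eq_square field_simps)
    also have "\<dots> \<ge> 0"
      using \<alpha> wt by (intro sum_nonneg mult_nonneg_nonneg add_nonneg_nonneg) auto
    finally show ?thesis .
  next
    case False
    show ?thesis
    proof (rule sum_nonneg)
      fix e
      have "p_plus D p e g = p_minus D p e g" "vn_plus D vx vy e g = - vn_minus D vx vy e g"
        using False by (simp_all add: p_plus_def vn_plus_def)
      note via = flux_power_via_neighbour[OF this]
      have "flux_power D \<alpha> p vx vy e g = (\<Sum>i<num_mortar_nodes D g. mortar_quad_weight D g i *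
          (\<alpha> * (vn_minus D vx vy e g $ i)\<^sup>2))"
        unfolding via
        by (intro sum.cong refl arg_cong[where f = "\<lambda>x. _ * x"])
           (simp add: Let_def power2_eq_square)
      also have "\<dots> \<ge> 0"
        using \<alpha> wt by (intro sum_nonneg mult_nonneg_nonneg) auto
      finally show "flux_power D \<alpha> p vx vy e g \<ge> 0" .
    qed
  qed
qed

lemma (in dg_discretization) total_flux_power_nonneg:
  assumes "\<alpha> \<ge> 0"
  shows "(\<Sum>e\<in>elements D. \<Sum>g\<in>elem_mortars D e. flux_power D \<alpha> p vx vy e g) \<ge> 0"
proof -
  have "(\<Sum>e\<in>elements D. \<Sum>g\<in>elem_mortars D e. flux_power D \<alpha> p vx vy e g)
      = (\<Sum>g\<in>mortars D. \<Sum>e | e \<in> elements D \<and> e \<in> connected_elems D g.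
          flux_power D \<alpha> p vx vy e g)"
    unfolding elem_mortars_def by (rule sum.swap_restrict[OF finite_elements finite_mortars])
  also have "\<dots> = (\<Sum>g\<in>mortars D. \<Sum>e\<in>connected_elems D g. flux_power D \<alpha> p vx vy e g)"
    by (intro sum.cong) (auto simp: connected_elems_def)
  also have "\<dots> \<ge> 0"
    by (intro sum_nonneg mortar_power_nonneg assms)
  finally show ?thesis .
qed


section \<open>Decay of the energy\<close>

lemma elem_energy_has_derivative:
  assumes sol: "scheme_solution D \<alpha> p vx vy" and e: "e \<in> elements D" and t: "t \<ge> 0"
    and fin: "finite (elem_mortars D e)" and sym: "transpose_mat (MJ D e) = MJ D e"
  shows "((\<lambda>\<tau>. elem_energy D (p \<tau>) (vx \<tau>) (vy \<tau>) e) has_real_derivative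
    - (\<Sum>g\<in>elem_mortars D e. flux_power D \<alpha> (p t) (vx t) (vy t) e g)) (at t within {0..})"
proof -
  have car: "p \<tau> e \<in> carrier_vec (dim_V D e)" "vx \<tau> e \<in> carrier_vec (dim_V D e)"
    "vy \<tau> e \<in> carrier_vec (dim_V D e)" if "\<tau> \<ge> 0" for \<tau>
    using sol e that by (auto simp: scheme_solution_def)
  obtain dp dvx dvy where
      deriv: "has_time_derivative (\<lambda>\<tau>. p \<tau> e) dp t" "has_time_derivative (\<lambda>\<tau>. vx \<tau> e) dvx t"
        "has_time_derivative (\<lambda>\<tau>. vy \<tau> e) dvy t"
    and eqs: "MJ D e *\<^sub>v dp + Sx D e *\<^sub>v vx t e + Sy D e *\<^sub>v vy t e =
            - finsum_vec TYPE(real) (dim_V D e)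
                (\<lambda>g. (transpose_mat (Lg D e g) * SJg D g * Wg D g) *\<^sub>v
                   (vn_star D \<alpha> (p t) (vx t) (vy t) e g - vn_minus D (vx t) (vy t) e g))
                (elem_mortars D e)"
          "MJ D e *\<^sub>v dvx - transpose_mat (Sx D e) *\<^sub>v p t e =
            - finsum_vec TYPE(real) (dim_V D e)
                (\<lambda>g. (transpose_mat (Lg D e g) * nx D e g * SJg D g * Wg D g) *\<^sub>v
                   p_star D \<alpha> (p t) (vx t) (vy t) e g)
                (elem_mortars D e)"
          "MJ D e *\<^sub>v dvy - transpose_mat (Sy D e) *\<^sub>v p t e =
            - finsum_vec TYPE(real) (dim_V D e)
                (\<lambda>g. (transpose_mat (Lg D e g) * ny D e g * SJg D g * Wg D g) *\<^sub>v
                   p_star D \<alpha> (p t) (vx t) (vy t) e g)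
                (elem_mortars D e)"
    using sol[unfolded scheme_solution_def, rule_format, OF t e] by blast
  have dcar: "dp \<in> carrier_vec (dim_V D e)" "dvx \<in> carrier_vec (dim_V D e)"
    "dvy \<in> carrier_vec (dim_V D e)"
    using deriv car[OF t] by (auto simp: has_time_derivative_def intro!: carrier_vecI)
  note quad = has_real_derivative_quadratic_form[OF MJ_carrier sym _ _ t]
  have deriv: "((\<lambda>\<tau>. elem_energy D (p \<tau>) (vx \<tau>) (vy \<tau>) e) has_real_derivative
      (2 * scalar_prod (p t e) (MJ D e *\<^sub>v dp) + 2 * scalar_prod (vx t e) (MJ D e *\<^sub>v dvx)
        + 2 * scalar_prod (vy t e) (MJ D e *\<^sub>v dvy)) / 2) (at t within {0..})"
    unfolding elem_energy_def
    by (intro DERIV_cdivide DERIV_add quad car deriv)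
  have "(2 * scalar_prod (p t e) (MJ D e *\<^sub>v dp) + 2 * scalar_prod (vx t e) (MJ D e *\<^sub>v dvx)
        + 2 * scalar_prod (vy t e) (MJ D e *\<^sub>v dvy)) / 2
      = - (\<Sum>g\<in>elem_mortars D e. flux_power D \<alpha> (p t) (vx t) (vy t) e g)"
    using elem_energy_balance[OF fin car[OF t] dcar eqs] by simp
  then show ?thesis
    by (rule DERIV_cong[OF deriv])
qed

theorem theorem3p1:
  fixes D :: "('e, 'g) discretization"
    and \<alpha> :: real
    and p vx vy :: "real \<Rightarrow> 'e \<Rightarrow> real vec"
  assumes "dg_discretization D"
    and "\<alpha> \<ge> 0"
    and "\<And>e. e \<in> elements D \<Longrightarrow> sym_pos_def (MJ D e)"
    and "\<And>g i. g \<in> mortars D \<Longrightarrow> i < num_mortar_nodes D g \<Longrightarrow> SJg D g $$ (i, i) > 0"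
    and "scheme_solution D \<alpha> p vx vy"
  shows "\<forall>t>0. energy D (p t) (vx t) (vy t) \<le> energy D (p 0) (vx 0) (vy 0)"
proof (intro allI impI)
  fix t :: real
  assume t: "t > 0"
  interpret dg_discretization D by fact
  let ?E = "\<lambda>\<tau>. energy D (p \<tau>) (vx \<tau>) (vy \<tau>)"
  let ?P = "\<lambda>\<tau>. \<Sum>e\<in>elements D. \<Sum>g\<in>elem_mortars D e. flux_power D \<alpha> (p \<tau>) (vx \<tau>) (vy \<tau>) e g"
  have deriv: "(?E has_real_derivative - ?P \<tau>) (at \<tau> within {0..})" if \<tau>: "\<tau> \<ge> 0" for \<tau>
  proof -
    have "((\<lambda>\<tau>. elem_energy D (p \<tau>) (vx \<tau>) (vy \<tau>) e) has_real_derivative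
        - (\<Sum>g\<in>elem_mortars D e. flux_power D \<alpha> (p \<tau>) (vx \<tau>) (vy \<tau>) e g)) (at \<tau> within {0..})"
      if e: "e \<in> elements D" for e
    proof (rule elem_energy_has_derivative[OF assms(5) e \<tau>])
      show "finite (elem_mortars D e)"
        using finite_mortars by (simp add: elem_mortars_def)
      show "transpose_mat (MJ D e) = MJ D e"
        using assms(3)[OF e] by (simp add: sym_pos_def_def)
    qed
    then have "(?E has_real_derivative (\<Sum>e\<in>elements D.
        - (\<Sum>g\<in>elem_mortars D e. flux_power D \<alpha> (p \<tau>) (vx \<tau>) (vy \<tau>) e g))) (at \<tau> within {0..})"
      unfolding energy_def by (rule DERIV_sum)
    then show ?thesis
      by (rule DERIV_cong) (rule sum_negf)
  qed
  show "?E t \<le> ?E 0"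
  proof (rule DERIV_nonpos_imp_decreasing_open[where f = ?E])
    show "0 \<le> t" using t by simp
    show "\<exists>y. DERIV ?E x :> y \<and> y \<le> 0" if "0 < x" "x < t" for x
    proof (intro exI conjI)
      show "DERIV ?E x :> - ?P x"
        using deriv[of x] that by (simp add: at_within_interior[of x "{0..}"])
      show "- ?P x \<le> 0"
        using total_flux_power_nonneg[OF assms(2)] by simp
    qed
    show "continuous_on {0..t} ?E"
      by (rule continuous_on_subset[of "{0..}"])
         (auto intro!: DERIV_continuous_on[where s = "{0..}"] deriv)
  qed
qed

end
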